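(* Let $G$ be the simply connected 4-dimensional Lie group whose Lie algebra has a basis $X_1,X_2,X_3,X_4$ with $$[X_2,X_3]=[X_3,X_1]=[X_1,X_2]=0,\quad [X_1,X_4]=X_2,\quad [X_2,X_4]=X_3,\quad [X_3,X_4]=0 .$$ For real numbers $a_1,\dots,a_6$ let $$Y_1=X_1+a_2X_2+a_3X_3,\quad Y_2=X_2+a_1X_3,\quad Y_3=X_3,\quad Y_4=a_4X_1+a_5X_2+a_6X_3+X_4 .$$ Suppose the left-invariant metric $g_0$ on $G$ is diagonal in the basis $Y_i$, i.e. $g_0(Y_i,Y_j)=\lambda_i\delta_{ij}$ with $\lambda_i>0$. Then the Ricci flow solution $g(t)$ with $g(0)=g_0$ remains diagonal in the basis $Y_i$ if and only if $a_1=a_2$.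
   Context: Elements of the Lie algebra are identified with left-invariant vector fields on $G$. The Ricci flow solution $g(t)$ is the left-invariant solution of $\frac{\partial}{\partial t}g(t)=-2\operatorname{Ric}(g(t))$, $g(0)=g_0$ (equivalently, the solution of the corresponding ODE on inner products on the Lie algebra). "$g(t)$ remains diagonal in the basis $Y_i$" means $g(t)(Y_i,Y_j)=0$ for all $i\ne j$ and all $t\ge0$ in its maximal interval of existence. *)

theory Defs
  imports "HOL-Analysis.Analysis"
begin

definition lie_bracket :: "('a::real_vector \<Rightarrow> 'a \<Rightarrow> 'a) \<Rightarrow> bool" where
  "lie_bracket br \<longleftrightarrow> bilinear br \<and> (\<forall>u. br u u = 0) \<and>
     (\<forall>u v w. br u (br v w) + br v (br w u) + br w (br u v) = 0)"

text \<open>A left-invariant Riemannian metric on a connected Lie group is represented by its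
  restriction to left-invariant vector fields, i.e. by an inner product on the Lie algebra.\<close>

definition inner_product :: "('a::real_vector \<Rightarrow> 'a \<Rightarrow> real) \<Rightarrow> bool" where
  "inner_product g \<longleftrightarrow> bilinear g \<and> (\<forall>u v. g u v = g v u) \<and> (\<forall>u. u \<noteq> 0 \<longrightarrow> g u u > 0)"

text \<open>The Levi-Civita connection on left-invariant fields: torsion-free and metric. The
  derivative term \<open>w (g (u, v))\<close> in the metric condition is absent because \<open>g (u, v)\<close> is
  constant on the group when \<open>u\<close>, \<open>v\<close> and \<open>g\<close> are left-invariant.\<close>

definition is_levi_civita ::
  "('a::real_vector \<Rightarrow> 'a \<Rightarrow> 'a) \<Rightarrow> ('a \<Rightarrow> 'a \<Rightarrow> real) \<Rightarrow> ('a \<Rightarrow> 'a \<Rightarrow> 'a) \<Rightarrow> bool" where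
  "is_levi_civita br g D \<longleftrightarrow> bilinear D \<and>
     (\<forall>u v. D u v - D v u = br u v) \<and>
     (\<forall>u v w. g (D w u) v + g u (D w v) = 0)"

definition levi_civita ::
  "('a::real_vector \<Rightarrow> 'a \<Rightarrow> 'a) \<Rightarrow> ('a \<Rightarrow> 'a \<Rightarrow> real) \<Rightarrow> 'a \<Rightarrow> 'a \<Rightarrow> 'a" where
  "levi_civita br g = (THE D. is_levi_civita br g D)"

definition riemann ::
  "('a::real_vector \<Rightarrow> 'a \<Rightarrow> 'a) \<Rightarrow> ('a \<Rightarrow> 'a \<Rightarrow> real) \<Rightarrow> 'a \<Rightarrow> 'a \<Rightarrow> 'a \<Rightarrow> 'a" where
  "riemann br g u v w =
     (let D = levi_civita br g in D u (D v w) - D v (D u w) - D (br u v) w)"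

text \<open>The inner product of the ambient type serves only to express the (basis-independent)
  trace of an endomorphism; it is unrelated to the metric \<open>g\<close>.\<close>

definition endo_trace :: "('a::euclidean_space \<Rightarrow> 'a) \<Rightarrow> real" where
  "endo_trace f = (\<Sum>b\<in>Basis. f b \<bullet> b)"

definition ricci ::
  "('a::euclidean_space \<Rightarrow> 'a \<Rightarrow> 'a) \<Rightarrow> ('a \<Rightarrow> 'a \<Rightarrow> real) \<Rightarrow> 'a \<Rightarrow> 'a \<Rightarrow> real" where
  "ricci br g v w = endo_trace (\<lambda>u. riemann br g u v w)"

text \<open>Left-invariant Ricci flow on \<open>[0,T)\<close>, where \<open>T = \<infinity>\<close> is allowed; the derivative at
  \<open>t = 0\<close> is one-sided.\<close>

definition ricci_flow_on ::
  "('a::euclidean_space \<Rightarrow> 'a \<Rightarrow> 'a) \<Rightarrow> ereal \<Rightarrow> (real \<Rightarrow> 'a \<Rightarrow> 'a \<Rightarrow> real) \<Rightarrow> bool" where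
  "ricci_flow_on br T g \<longleftrightarrow>
     (\<forall>t. 0 \<le> t \<and> ereal t < T \<longrightarrow> inner_product (g t) \<and>
        (\<forall>u v. ((\<lambda>s. g s u v) has_real_derivative - 2 * ricci br (g t) u v)
                 (at t within {s. 0 \<le> s \<and> ereal s < T})))"

definition maximal_ricci_flow ::
  "('a::euclidean_space \<Rightarrow> 'a \<Rightarrow> 'a) \<Rightarrow> ('a \<Rightarrow> 'a \<Rightarrow> real) \<Rightarrow> ereal \<Rightarrow>
     (real \<Rightarrow> 'a \<Rightarrow> 'a \<Rightarrow> real) \<Rightarrow> bool" where
  "maximal_ricci_flow br g0 T g \<longleftrightarrow>
     0 < T \<and> ricci_flow_on br T g \<and> g 0 = g0 \<and>
     \<not> (\<exists>T' g'. T < T' \<and> ricci_flow_on br T' g' \<and>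
          (\<forall>t. 0 \<le> t \<and> ereal t < T \<longrightarrow> g' t = g t))"

end

theory Submission imports Defs begin

text \<open>Orthogonalising a left-invariant metric along the flag spanned by \<open>Y\<^sub>3, Y\<^sub>2, Y\<^sub>1, Y\<^sub>4\<close>
  gives an orthogonal frame \<open>Z\<^sub>i\<close> with \<open>[Z\<^sub>1, Z\<^sub>4] = Z\<^sub>2 + c Z\<^sub>3\<close>, \<open>[Z\<^sub>2, Z\<^sub>4] = Z\<^sub>3\<close> and all
  other brackets zero. In such a frame the only off-diagonal Ricci components are
  \<open>Ric(Z\<^sub>1, Z\<^sub>2)\<close> and \<open>Ric(Z\<^sub>2, Z\<^sub>3)\<close>, which are nonzero multiples of \<open>c\<close>. The basis \<open>Y\<^sub>i\<close> is itself
  such a frame for \<open>g\<^sub>0\<close> with \<open>c = a\<^sub>2 - a\<^sub>1\<close>, so a diagonal solution forces \<open>a\<^sub>1 = a\<^sub>2\<close>.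
  Conversely, if \<open>a\<^sub>1 = a\<^sub>2\<close>, the value \<open>c(t)\<close> belonging to \<open>g(t)\<close> solves a linear equation
  \<open>c' = - k c\<close> with \<open>k \<ge> 0\<close> and \<open>c(0) = 0\<close>, hence vanishes. Then the Ricci tensor is diagonal in
  the frame, and the ratios \<open>g(Y\<^sub>i, Y\<^sub>j) / g(Y\<^sub>j, Y\<^sub>j)\<close> are constant one after the other, which
  needs no uniqueness theorem for the flow.\<close>

section \<open>Ricci curvature of an inner product on a Lie algebra\<close>

lemma inner_product_linear:
  assumes "inner_product g"
  shows "g (x + y) z = g x z + g y z" "g x (y + z) = g x y + g x z"
    "g (x - y) z = g x z - g y z" "g x (y - z) = g x y - g x z"
    "g (r *\<^sub>R x) z = r * g x z" "g x (r *\<^sub>R z) = r * g x z"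
    "g (- x) z = - g x z" "g x (- z) = - g x z"
    "g 0 z = 0" "g x 0 = 0"
  using assms unfolding inner_product_def
  by (auto simp: bilinear_ladd bilinear_radd bilinear_lsub bilinear_rsub bilinear_lmul
      bilinear_rmul bilinear_lneg bilinear_rneg bilinear_lzero bilinear_rzero)

lemma inner_product_commute: "inner_product g \<Longrightarrow> g x y = g y x"
  unfolding inner_product_def by blast

lemma inner_product_pos: "inner_product g \<Longrightarrow> x \<noteq> 0 \<Longrightarrow> 0 < g x x"
  unfolding inner_product_def by blast

lemma inner_product_eqI:
  assumes "inner_product g" "\<And>w. g x w = g y w"
  shows "x = y"
proof -
  have "g (x - y) (x - y) = 0"
    using assms(2) by (simp add: inner_product_linear[OF assms(1)])
  then show ?thesis
    using inner_product_pos[OF assms(1), of "x - y"] by auto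
qed

lemma linear_inner_product:
  assumes "inner_product g"
  shows "linear (g x)" "linear (\<lambda>x. g x y)"
  using assms unfolding inner_product_def bilinear_def by auto

lemma inner_product_eq_on_span:
  assumes g: "inner_product g" and span: "span S = UNIV"
    and eq: "\<And>w. w \<in> S \<Longrightarrow> g x w = g y w"
  shows "x = y"
proof (rule inner_product_eqI[OF g])
  fix w
  show "g x w = g y w"
    using linear_eq_on_span[OF linear_inner_product(1)[OF g] linear_inner_product(1)[OF g] eq]
      span by auto
qed

text \<open>The coordinate map \<open>F\<close> is injective because \<open>g\<close> is
  nondegenerate, hence surjective in finite dimension; this turns the Koszul formula into a
  vector.\<close>

lemma inner_product_riesz:
  fixes \<phi> :: "'a::euclidean_space \<Rightarrow> real"
  assumes g: "inner_product g" and \<phi>: "linear \<phi>"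
  shows "\<exists>z. \<forall>w. g z w = \<phi> w"
proof -
  define F where "F z = (\<Sum>b\<in>Basis. g z b *\<^sub>R b)" for z
  have F_inner: "F z \<bullet> b = g z b" if "b \<in> Basis" for z b
    using that by (simp add: F_def)
  have "linear F"
    by (rule linearI) (simp_all add: F_def inner_product_linear[OF g] scaleR_left_distrib
        sum.distrib scaleR_sum_right)
  moreover have "inj F"
    by (rule injI, rule inner_product_eq_on_span[OF g span_Basis]) (metis F_inner)
  ultimately have "surj F"
    by (rule linear_inj_imp_surj)
  then obtain z where "F z = (\<Sum>b\<in>Basis. \<phi> b *\<^sub>R b)"
    by (metis surjD)
  then have "g z b = \<phi> b" if "b \<in> Basis" for b
    using F_inner[OF that, of z] that by simp
  then have "g z = \<phi>"
    by (intro linear_eq_stdbasis[OF linear_inner_product(1)[OF g] \<phi>])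
  then show ?thesis by auto
qed

section \<open>Existence and uniqueness of the Levi-Civita connection\<close>

lemma lie_bracket_linear:
  assumes "lie_bracket br"
  shows "br (x + y) z = br x z + br y z" "br x (y + z) = br x y + br x z"
    "br (x - y) z = br x z - br y z" "br x (y - z) = br x y - br x z"
    "br (r *\<^sub>R x) z = r *\<^sub>R br x z" "br x (r *\<^sub>R z) = r *\<^sub>R br x z"
    "br x x = 0"
  using assms unfolding lie_bracket_def
  by (auto simp: bilinear_ladd bilinear_radd bilinear_lsub bilinear_rsub bilinear_lmul
      bilinear_rmul)

lemma lie_bracket_anti:
  assumes "lie_bracket br"
  shows "br x y = - br y x"
proof -
  have "br (x + y) (x + y) = 0" "br x x = 0" "br y y = 0"
    using lie_bracket_linear(7)[OF assms] by auto
  then have "br y x + br x y = 0"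
    by (simp add: lie_bracket_linear(1,2)[OF assms])
  then show ?thesis by (simp add: eq_neg_iff_add_eq_0 add.commute)
qed

text \<open>Metric compatibility in each of the three directions is combined with torsion-freeness.
  The right side is free of \<open>D\<close>, so it determines \<open>D\<close>.\<close>

lemma koszul:
  assumes g: "inner_product g" and D: "is_levi_civita br g D"
  shows "2 * g (D x y) z = g (br x y) z - g (br y z) x + g (br z x) y"
proof -
  have br: "br u v = D u v - D v u" for u v
    using D unfolding is_levi_civita_def by auto
  have met: "g (D w u) v = - g (D w v) u" for u v w
    using D inner_product_commute[OF g] unfolding is_levi_civita_def
    by (metis eq_neg_iff_add_eq_0)
  show ?thesis
    using met[of x y z] met[of y x z] met[of z x y]
    by (simp add: br inner_product_linear[OF g])
qed

text \<open>Half the Koszul right side, \<open>k\<close>, is linear in its last argument, so it is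
  represented by a vector \<open>D x y\<close>; antisymmetry of the bracket then gives both defining
  identities.\<close>

lemma ex_levi_civita:
  fixes br :: "'a::euclidean_space \<Rightarrow> 'a \<Rightarrow> 'a"
  assumes g: "inner_product g" and L: "lie_bracket br"
  shows "\<exists>D. is_levi_civita br g D"
proof -
  note gl = inner_product_linear[OF g] and bl = lie_bracket_linear[OF L]
  define k where "k x y z = (g (br x y) z - g (br y z) x + g (br z x) y) / 2" for x y z
  have k: "k (x + x') y z = k x y z + k x' y z" "k x (y + y') z = k x y z + k x y' z"
    "k x y (z + z') = k x y z + k x y z'" "k (r *\<^sub>R x) y z = r * k x y z"
    "k x (r *\<^sub>R y) z = r * k x y z" "k x y (r *\<^sub>R z) = r * k x y z" for x x' y y' z z' r
    unfolding k_def by (simp_all add: gl bl field_simps)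
  have "linear (k x y)" for x y
    by (rule linearI) (simp_all add: k)
  then have "\<exists>D. \<forall>z. g D z = k x y z" for x y
    using inner_product_riesz[OF g] by blast
  then obtain D where D: "g (D x y) z = k x y z" for x y z
    by metis
  have "bilinear D"
    unfolding bilinear_def
    by (safe; rule linearI; rule inner_product_eqI[OF g]) (simp_all add: D gl k)
  moreover have "D u v - D v u = br u v" for u v
  proof (rule inner_product_eqI[OF g])
    fix w
    show "g (D u v - D v u) w = g (br u v) w"
      by (simp add: gl D k_def lie_bracket_anti[OF L, of v u] lie_bracket_anti[OF L, of w u]
          lie_bracket_anti[OF L, of w v] field_simps)
  qed
  moreover have "g (D w u) v + g u (D w v) = 0" for u v w
    by (simp add: D k_def inner_product_commute[OF g, of u] gl lie_bracket_anti[OF L, of v u]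
          lie_bracket_anti[OF L, of w u] lie_bracket_anti[OF L, of w v] field_simps)
  ultimately show ?thesis
    unfolding is_levi_civita_def by blast
qed

text \<open>Justifies the description operator in \<open>levi_civita\<close>: two candidates agree
  by \<open>koszul\<close> and nondegeneracy.\<close>

lemma levi_civita_is_levi_civita:
  fixes br :: "'a::euclidean_space \<Rightarrow> 'a \<Rightarrow> 'a"
  assumes g: "inner_product g" and L: "lie_bracket br"
  shows "is_levi_civita br g (levi_civita br g)"
proof -
  have "D = D'" if "is_levi_civita br g D" "is_levi_civita br g D'" for D D'
  proof (intro ext)
    fix x y
    show "D x y = D' x y"
    proof (rule inner_product_eqI[OF g])
      fix z
      show "g (D x y) z = g (D' x y) z"
        using koszul[OF g that(1), of x y z] koszul[OF g that(2), of x y z] by simp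
    qed
  qed
  then show ?thesis
    unfolding levi_civita_def using ex_levi_civita[OF assms] by (metis theI')
qed

section \<open>Linearity of the Ricci tensor and traces in orthogonal bases\<close>

lemma linear_ricci:
  fixes br :: "'a::euclidean_space \<Rightarrow> 'a \<Rightarrow> 'a"
  assumes g: "inner_product g" and L: "lie_bracket br"
  shows "ricci br g (x - y) z = ricci br g x z - ricci br g y z"
    "ricci br g x (y - z) = ricci br g x y - ricci br g x z"
    "ricci br g (r *\<^sub>R x) z = r * ricci br g x z"
    "ricci br g x (r *\<^sub>R z) = r * ricci br g x z"
proof -
  have "bilinear (levi_civita br g)"
    using levi_civita_is_levi_civita[OF assms] unfolding is_levi_civita_def by blast
  note Dl = bilinear_lsub[OF this] bilinear_rsub[OF this] bilinear_lmul[OF this]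
    bilinear_rmul[OF this]
  show "ricci br g (x - y) z = ricci br g x z - ricci br g y z"
    "ricci br g x (y - z) = ricci br g x y - ricci br g x z"
    "ricci br g (r *\<^sub>R x) z = r * ricci br g x z"
    "ricci br g x (r *\<^sub>R z) = r * ricci br g x z"
    unfolding ricci_def endo_trace_def riemann_def Let_def
    by (simp_all add: Dl lie_bracket_linear[OF L] inner_diff_left inner_add_left
        sum_distrib_left sum_subtractf sum.distrib right_diff_distrib)
qed

text \<open>Expanding each ambient basis vector in the orthogonal set \<open>S\<close> and
  exchanging the two sums moves the trace from \<open>Basis\<close> to \<open>S\<close>.\<close>

lemma endo_trace_orthogonal:
  fixes f :: "'a::euclidean_space \<Rightarrow> 'a"
  assumes g: "inner_product g" and f: "linear f" and "finite S" and span: "span S = UNIV"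
    and ortho: "\<And>x y. x \<in> S \<Longrightarrow> y \<in> S \<Longrightarrow> x \<noteq> y \<Longrightarrow> g x y = 0" and "0 \<notin> S"
  shows "endo_trace f = (\<Sum>z\<in>S. g (f z) z / g z z)"
proof -
  have g_sum: "g (\<Sum>i\<in>A. F i) y = (\<Sum>i\<in>A. g (F i) y)" for A y and F :: "'a \<Rightarrow> 'a"
    by (rule linear_sum[OF linear_inner_product(2)[OF g]])
  have expand: "b = (\<Sum>z\<in>S. (g b z / g z z) *\<^sub>R z)" for b
  proof (rule inner_product_eq_on_span[OF g span])
    fix w assume w: "w \<in> S"
    then have "w \<noteq> 0"
      using \<open>0 \<notin> S\<close> by blast
    then have "g w w \<noteq> 0"
      using inner_product_pos[OF g] by force
    have "(\<Sum>z\<in>S. g b z / g z z * g z w) = (\<Sum>z\<in>S. if z = w then g b w else 0)"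
      using ortho w \<open>g w w \<noteq> 0\<close> by (intro sum.cong) auto
    then show "g b w = g (\<Sum>z\<in>S. (g b z / g z z) *\<^sub>R z) w"
      using w \<open>finite S\<close> by (simp add: g_sum inner_product_linear[OF g])
  qed
  have "endo_trace f = (\<Sum>b\<in>Basis. f (\<Sum>z\<in>S. (g b z / g z z) *\<^sub>R z) \<bullet> b)"
    unfolding endo_trace_def using expand by simp
  also have "\<dots> = (\<Sum>b\<in>Basis. \<Sum>z\<in>S. g b z / g z z * (f z \<bullet> b))"
    by (simp add: linear_sum[OF f] linear_scale[OF f] inner_sum_left)
  also have "\<dots> = (\<Sum>z\<in>S. g (\<Sum>b\<in>Basis. (f z \<bullet> b) *\<^sub>R b) z / g z z)"
    by (subst sum.swap)
      (simp add: g_sum inner_product_linear[OF g] sum_divide_distrib mult.commute)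
  finally show ?thesis
    by (simp add: euclidean_representation)
qed

section \<open>Orthogonal frames of the Engel algebra\<close>

lemma spanning_four_basis:
  fixes Z1 Z2 Z3 Z4 :: "'a::euclidean_space"
  assumes dim: "DIM('a) = 4" and span: "span {Z1, Z2, Z3, Z4} = UNIV"
  shows "distinct [Z1, Z2, Z3, Z4]" "0 \<notin> {Z1, Z2, Z3, Z4}"
proof -
  have "DIM('a) \<le> card {Z1, Z2, Z3, Z4}"
    using dim_le_card[of UNIV "{Z1, Z2, Z3, Z4}"] span by simp
  then have card: "card {Z1, Z2, Z3, Z4} = length [Z1, Z2, Z3, Z4]"
    using dim card_length[of "[Z1, Z2, Z3, Z4]"] by simp
  then show "distinct [Z1, Z2, Z3, Z4]"
    by (intro card_distinct) simp
  have "independent {Z1, Z2, Z3, Z4}"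
    by (rule card_le_dim_spanning[of _ UNIV]) (use card dim span in auto)
  then show "0 \<notin> {Z1, Z2, Z3, Z4}"
    by (metis dependent_zero)
qed

lemma span_UNIV_mono:
  assumes "span A = UNIV" "A \<subseteq> span B"
  shows "span B = UNIV"
  using span_minimal[OF assms(2) subspace_span] assms(1) by (simp add: top.extremum_unique)

text \<open>The frame is orthogonal but not normalised: the bracket constants stay 1 and
  \<open>c\<close>, and the metric enters only through four squared norms.\<close>

locale orthogonal_engel_frame =
  fixes br :: "'a::euclidean_space \<Rightarrow> 'a \<Rightarrow> 'a" and g :: "'a \<Rightarrow> 'a \<Rightarrow> real"
    and Z1 Z2 Z3 Z4 :: 'a and c :: real
  assumes L: "lie_bracket br" and g: "inner_product g"
    and dim: "DIM('a) = 4" and span: "span {Z1, Z2, Z3, Z4} = UNIV"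
    and brackets: "br Z1 Z2 = 0" "br Z1 Z3 = 0" "br Z2 Z3 = 0"
      "br Z1 Z4 = Z2 + c *\<^sub>R Z3" "br Z2 Z4 = Z3" "br Z3 Z4 = 0"
    and ortho: "g Z1 Z2 = 0" "g Z1 Z3 = 0" "g Z1 Z4 = 0" "g Z2 Z3 = 0" "g Z2 Z4 = 0" "g Z3 Z4 = 0"
begin

lemmas basis = spanning_four_basis[OF dim span] span

abbreviation "D \<equiv> levi_civita br g"
abbreviation "m1 \<equiv> g Z1 Z1"
abbreviation "m2 \<equiv> g Z2 Z2"
abbreviation "m3 \<equiv> g Z3 Z3"
abbreviation "m4 \<equiv> g Z4 Z4"

lemma norms_pos: "0 < m1" "0 < m2" "0 < m3" "0 < m4"
  using basis(2) by (auto intro!: inner_product_pos[OF g])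

lemma norms_nonzero: "m1 \<noteq> 0" "m2 \<noteq> 0" "m3 \<noteq> 0" "m4 \<noteq> 0"
  using norms_pos by auto

lemma ortho': "g Z2 Z1 = 0" "g Z3 Z1 = 0" "g Z4 Z1 = 0" "g Z3 Z2 = 0" "g Z4 Z2 = 0" "g Z4 Z3 = 0"
  using ortho by (simp_all add: inner_product_commute[OF g])

lemma brackets': "br Z2 Z1 = 0" "br Z3 Z1 = 0" "br Z3 Z2 = 0"
    "br Z4 Z1 = - Z2 - c *\<^sub>R Z3" "br Z4 Z2 = - Z3" "br Z4 Z3 = 0"
  by (subst lie_bracket_anti[OF L], simp add: brackets)+

text \<open>A guessed value of \<open>D x y\<close> is certified by testing the Koszul formula on
  the four frame vectors.\<close>

lemma levi_civitaI:
  assumes "g (br x y) Z1 - g (br y Z1) x + g (br Z1 x) y = 2 * g z Z1"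
    "g (br x y) Z2 - g (br y Z2) x + g (br Z2 x) y = 2 * g z Z2"
    "g (br x y) Z3 - g (br y Z3) x + g (br Z3 x) y = 2 * g z Z3"
    "g (br x y) Z4 - g (br y Z4) x + g (br Z4 x) y = 2 * g z Z4"
  shows "D x y = z"
proof (rule inner_product_eq_on_span[OF g basis(3)])
  fix w assume "w \<in> {Z1, Z2, Z3, Z4}"
  then show "g (D x y) w = g z w"
    using koszul[OF g levi_civita_is_levi_civita[OF g L], of x y w] assms by auto
qed

lemma levi_civita_frame:
  "D Z1 Z1 = 0" "D Z2 Z2 = 0" "D Z3 Z3 = 0" "D Z4 Z4 = 0"
  "D Z1 Z2 = - (m2 / (2 * m4)) *\<^sub>R Z4" "D Z2 Z1 = - (m2 / (2 * m4)) *\<^sub>R Z4"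
  "D Z1 Z3 = - (c * m3 / (2 * m4)) *\<^sub>R Z4" "D Z3 Z1 = - (c * m3 / (2 * m4)) *\<^sub>R Z4"
  "D Z2 Z3 = - (m3 / (2 * m4)) *\<^sub>R Z4" "D Z3 Z2 = - (m3 / (2 * m4)) *\<^sub>R Z4"
  "D Z1 Z4 = (1 / 2) *\<^sub>R Z2 + (c / 2) *\<^sub>R Z3"
  "D Z4 Z1 = - (1 / 2) *\<^sub>R Z2 - (c / 2) *\<^sub>R Z3"
  "D Z2 Z4 = (m2 / (2 * m1)) *\<^sub>R Z1 + (1 / 2) *\<^sub>R Z3"
  "D Z4 Z2 = (m2 / (2 * m1)) *\<^sub>R Z1 - (1 / 2) *\<^sub>R Z3"
  "D Z3 Z4 = (c * m3 / (2 * m1)) *\<^sub>R Z1 + (m3 / (2 * m2)) *\<^sub>R Z2"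
  "D Z4 Z3 = (c * m3 / (2 * m1)) *\<^sub>R Z1 + (m3 / (2 * m2)) *\<^sub>R Z2"
  by (rule levi_civitaI; simp add: brackets brackets' ortho ortho' norms_nonzero
      inner_product_linear[OF g] lie_bracket_linear(7)[OF L])+

lemma bilinear_levi_civita: "bilinear D"
  using levi_civita_is_levi_civita[OF g L] unfolding is_levi_civita_def by blast

lemma ricci_eq:
  "ricci br g x y = g (riemann br g Z1 x y) Z1 / m1 + g (riemann br g Z2 x y) Z2 / m2
    + g (riemann br g Z3 x y) Z3 / m3 + g (riemann br g Z4 x y) Z4 / m4"
proof -
  note B = bilinear_levi_civita
  have "linear (\<lambda>u. riemann br g u x y)"
    by (rule linearI)
      (simp_all add: riemann_def Let_def bilinear_ladd[OF B] bilinear_radd[OF B] bilinear_lmul[OF B]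
        bilinear_rmul[OF B] lie_bracket_linear[OF L] algebra_simps)
  then have "ricci br g x y = (\<Sum>z\<in>{Z1, Z2, Z3, Z4}. g (riemann br g z x y) z / g z z)"
    unfolding ricci_def
    by (rule endo_trace_orthogonal[OF g _ _ basis(3) _ basis(2)]) (auto simp: ortho ortho')
  then show ?thesis
    using basis(1) by simp
qed

lemmas ricci_simps = ricci_eq riemann_def Let_def brackets brackets' levi_civita_frame
  bilinear_ladd[OF bilinear_levi_civita] bilinear_radd[OF bilinear_levi_civita]
  bilinear_lsub[OF bilinear_levi_civita] bilinear_rsub[OF bilinear_levi_civita]
  bilinear_lmul[OF bilinear_levi_civita] bilinear_rmul[OF bilinear_levi_civita]
  bilinear_lneg[OF bilinear_levi_civita] bilinear_rneg[OF bilinear_levi_civita]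
  bilinear_lzero[OF bilinear_levi_civita] bilinear_rzero[OF bilinear_levi_civita]
  inner_product_linear[OF g] lie_bracket_linear(7)[OF L] ortho ortho'

text \<open>Direct expansion from the connection table. The two entries with \<open>c\<close>
  reflect that \<open>br Z1 Z4\<close> has a component along \<open>br Z2 Z4 = Z3\<close> and
  components along both \<open>Z2\<close> and \<open>Z3\<close>.\<close>

lemma ricci_frame:
  "ricci br g Z1 Z2 = - c * m3 / (2 * m4)" "ricci br g Z2 Z3 = c * m2 * m3 / (2 * m1 * m4)"
  "ricci br g Z1 Z3 = 0"
  "ricci br g Z4 Z1 = 0" "ricci br g Z4 Z2 = 0" "ricci br g Z4 Z3 = 0"
  by (simp_all only: ricci_simps) (simp_all add: norms_nonzero ricci_simps field_simps)

lemma ricci_frame':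
  "ricci br g Z2 Z1 = - c * m3 / (2 * m4)" "ricci br g Z3 Z2 = c * m2 * m3 / (2 * m1 * m4)"
  "ricci br g Z3 Z1 = 0"
  by (simp_all only: ricci_simps) (simp_all add: norms_nonzero ricci_simps field_simps)

end

section \<open>The Ricci flow on the Engel algebra\<close>

text \<open>The coefficient \<open>k\<close> may vary with \<open>t\<close>; its sign alone makes
  the square of \<open>f\<close> nonincreasing, and that square starts at 0.\<close>

lemma decay_ode_zero:
  fixes f :: "real \<Rightarrow> real"
  assumes "0 \<le> b" "f 0 = 0"
    and deriv: "\<And>t. t \<in> {0..b} \<Longrightarrow> \<exists>k\<ge>0. (f has_real_derivative - k * f t) (at t within {0..b})"
  shows "f b = 0"
proof (cases "b = 0")
  case False
  have "(f b)\<^sup>2 \<le> (f 0)\<^sup>2"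
  proof (rule DERIV_nonpos_imp_decreasing_open[OF \<open>0 \<le> b\<close>])
    fix t assume t: "0 < t" "t < b"
    then obtain k where k: "k \<ge> 0" "(f has_real_derivative - k * f t) (at t)"
      using deriv[of t] by (auto simp: at_within_Icc_at)
    have "((\<lambda>t. (f t)\<^sup>2) has_real_derivative - 2 * k * (f t)\<^sup>2) (at t)"
      by (rule DERIV_cong[OF DERIV_power[OF k(2)]]) (simp add: power2_eq_square)
    then show "\<exists>y. ((\<lambda>t. (f t)\<^sup>2) has_real_derivative y) (at t) \<and> y \<le> 0"
      using k(1) by (intro exI[of _ "- 2 * k * (f t)\<^sup>2"]) auto
  next
    have "continuous_on {0..b} f"
      using deriv has_field_derivative_imp_has_derivative has_derivative_continuous
      unfolding continuous_on_eq_continuous_within by blast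
    then show "continuous_on {0..b} (\<lambda>t. (f t)\<^sup>2)"
      by (intro continuous_intros)
  qed
  then show ?thesis
    using assms(2) by simp
qed (use assms in simp)

text \<open>This is the case \<open>a1 = a2\<close>, in which the \<open>Y\<close> basis satisfies
  the same bracket relations as the \<open>X\<close> basis.\<close>

locale engel_basis =
  fixes br :: "'a::euclidean_space \<Rightarrow> 'a \<Rightarrow> 'a" and Y1 Y2 Y3 Y4 :: 'a
  assumes L: "lie_bracket br"
    and dim: "DIM('a) = 4" and span: "span {Y1, Y2, Y3, Y4} = UNIV"
    and brackets: "br Y1 Y2 = 0" "br Y1 Y3 = 0" "br Y2 Y3 = 0"
      "br Y1 Y4 = Y2" "br Y2 Y4 = Y3" "br Y3 Y4 = 0"
begin

text \<open>Here \<open>v\<close> and \<open>w\<close> solve, by Cramer's rule, the system making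
  \<open>Z1\<close> orthogonal to \<open>Y2\<close> and \<open>Y3\<close>. The constant
  \<open>u - v\<close> arises from \<open>br Z1 Y4 = Y2 - v *\<^sub>R Y3\<close> on rewriting
  \<open>Y2\<close> through \<open>Z2\<close>.\<close>

lemma gram_schmidt:
  assumes g: "inner_product g"
    and u: "u = g Y2 Y3 / g Y3 Y3"
    and v: "v = (g Y1 Y2 * g Y3 Y3 - g Y1 Y3 * g Y3 Y2) / (g Y2 Y2 * g Y3 Y3 - g Y2 Y3 * g Y3 Y2)"
    and w: "w = (g Y1 Y3 - v * g Y2 Y3) / g Y3 Y3"
  defines "Z1 \<equiv> Y1 - v *\<^sub>R Y2 - w *\<^sub>R Y3" and "Z2 \<equiv> Y2 - u *\<^sub>R Y3"
  shows "g Y2 Y2 * g Y3 Y3 - g Y2 Y3 * g Y3 Y2 = g Y3 Y3 * g Z2 Z2"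
    "\<exists>q1 q2 q3. orthogonal_engel_frame br g Z1 Z2 Y3
       (Y4 - q1 *\<^sub>R Z1 - q2 *\<^sub>R Z2 - q3 *\<^sub>R Y3) (u - v)"
proof -
  note gl = inner_product_linear[OF g]
  have pos3: "0 < g Y3 Y3"
    using spanning_four_basis(2)[OF dim span] inner_product_pos[OF g] by auto
  have ortho23: "g Z2 Y3 = 0"
    using pos3 by (simp add: Z2_def gl u)
  have sym: "g Y3 Y2 = g Y2 Y3" "g Y2 Y1 = g Y1 Y2" "g Y3 Y1 = g Y1 Y3"
    by (simp_all add: inner_product_commute[OF g])
  show den: "g Y2 Y2 * g Y3 Y3 - g Y2 Y3 * g Y3 Y2 = g Y3 Y3 * g Z2 Z2"
    using pos3 by (simp add: Z2_def gl u sym field_simps)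
  have mem: "Y1 \<in> span {Z1, Z2, Y3, Z4}" "Y2 \<in> span {Z1, Z2, Y3, Z4}"
    "Y3 \<in> span {Z1, Z2, Y3, Z4}" "Z1 \<in> span {Z1, Z2, Y3, Z4}" "Z2 \<in> span {Z1, Z2, Y3, Z4}"
    "Z4 \<in> span {Z1, Z2, Y3, Z4}" for Z4
  proof -
    let ?S = "span {Z1, Z2, Y3, Z4}"
    show Z: "Y3 \<in> ?S" "Z1 \<in> ?S" "Z2 \<in> ?S" "Z4 \<in> ?S"
      by (auto intro: span_base)
    have "Z2 + u *\<^sub>R Y3 \<in> ?S"
      using Z by (intro span_add span_scale)
    then show Y2: "Y2 \<in> ?S"
      by (simp add: Z2_def)
    have "Z1 + v *\<^sub>R Y2 + w *\<^sub>R Y3 \<in> ?S"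
      using Z Y2 by (intro span_add span_scale)
    then show "Y1 \<in> ?S"
      by (simp add: Z1_def)
  qed
  \<comment> \<open>This gives \<open>Z2\<close> nonzero, so the Gram determinant in the denominator
    of \<open>v\<close> is positive.\<close>
  have "span {Z1, Z2, Y3, Y4} = UNIV"
    by (rule span_UNIV_mono[OF span]) (use mem[of Y4] in auto)
  then have pos2: "0 < g Z2 Z2"
    using spanning_four_basis(2)[OF dim] inner_product_pos[OF g] by auto
  have w': "w * g Y3 Y3 = g Y1 Y3 - v * g Y2 Y3"
    using pos3 by (simp add: w)
  have u': "u * g Y3 Y3 = g Y2 Y3"
    using pos3 by (simp add: u)
  have "v * (g Y2 Y2 * g Y3 Y3 - g Y2 Y3 * g Y3 Y2) = g Y1 Y2 * g Y3 Y3 - g Y1 Y3 * g Y3 Y2"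
    using pos2 pos3 by (simp add: den v)
  \<comment> \<open>The second factor is \<open>g Z1 Y2\<close>, and the first is positive.\<close>
  then have "g Y3 Y3 * (g Y1 Y2 - v * g Y2 Y2 - w * g Y2 Y3) = 0"
    using w' sym by algebra
  then have ortho: "g Z1 Y3 = 0" "g Z1 Y2 = 0"
    using pos3 w' by (simp_all add: Z1_def gl sym)
  then have ortho12: "g Z1 Z2 = 0"
    by (simp add: Z2_def gl)
  define q where "q z = g Y4 z / g z z" for z
  define Z4 where "Z4 = Y4 - q Z1 *\<^sub>R Z1 - q Z2 *\<^sub>R Z2 - q Y3 *\<^sub>R Y3"
  have q: "q z * g z z = g Y4 z" for z
    using inner_product_pos[OF g, of z] gl(10) by (cases "z = 0") (auto simp: q_def)
  have ortho_sym: "g Z2 Z1 = 0" "g Y3 Z1 = 0" "g Y3 Z2 = 0"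
    using ortho ortho12 ortho23 by (simp_all add: inner_product_commute[OF g])
  have ortho4: "g Z4 Z1 = 0" "g Z4 Z2 = 0" "g Z4 Y3 = 0"
    using q ortho ortho12 ortho23 ortho_sym by (simp_all add: Z4_def gl)
  then have ortho4: "g Z1 Z4 = 0" "g Z2 Z4 = 0" "g Y3 Z4 = 0"
    by (simp_all add: inner_product_commute[OF g])
  have "Z4 + q Z1 *\<^sub>R Z1 + q Z2 *\<^sub>R Z2 + q Y3 *\<^sub>R Y3 \<in> span {Z1, Z2, Y3, Z4}"
    using mem[of Z4] by (intro span_add span_scale)
  then have "Y4 \<in> span {Z1, Z2, Y3, Z4}"
    by (simp add: Z4_def)
  then have span': "span {Z1, Z2, Y3, Z4} = UNIV"
    by (intro span_UNIV_mono[OF span]) (use mem[of Z4] in auto)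
  have anti: "br Y2 Y1 = 0" "br Y3 Y1 = 0" "br Y3 Y2 = 0"
    by (subst lie_bracket_anti[OF L], simp add: brackets)+
  have "orthogonal_engel_frame br g Z1 Z2 Y3 Z4 (u - v)"
  proof
    \<comment> \<open>The corrections to \<open>Y4\<close> lie in the abelian span of
      \<open>Y1\<close>, \<open>Y2\<close>, \<open>Y3\<close>, so they leave these brackets
      unchanged.\<close>
    show "br Z1 Z4 = Z2 + (u - v) *\<^sub>R Y3" "br Z2 Z4 = Y3" "br Y3 Z4 = 0" "br Z1 Z2 = 0"
      "br Z1 Y3 = 0" "br Z2 Y3 = 0"
      by (simp_all add: Z4_def Z1_def Z2_def lie_bracket_linear[OF L] brackets anti algebra_simps)
  qed (use L g dim span' ortho ortho12 ortho23 ortho4 in auto)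
  then show "\<exists>q1 q2 q3. orthogonal_engel_frame br g Z1 Z2 Y3
       (Y4 - q1 *\<^sub>R Z1 - q2 *\<^sub>R Z2 - q3 *\<^sub>R Y3) (u - v)"
    unfolding Z4_def by blast
qed

end

section \<open>Evolution of the Gram-Schmidt coefficients along the flow\<close>

locale engel_flow = engel_basis br Y1 Y2 Y3 Y4
  for br :: "'a::euclidean_space \<Rightarrow> 'a \<Rightarrow> 'a" and Y1 Y2 Y3 Y4 :: 'a +
  fixes T :: ereal and g :: "real \<Rightarrow> 'a \<Rightarrow> 'a \<Rightarrow> real"
  assumes flow: "ricci_flow_on br T g"
    and initial: "g 0 Y1 Y2 = 0" "g 0 Y1 Y3 = 0" "g 0 Y2 Y3 = 0"
      "g 0 Y4 Y1 = 0" "g 0 Y4 Y2 = 0" "g 0 Y4 Y3 = 0"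
begin

lemma inner_product_flow: "0 \<le> t \<Longrightarrow> ereal t < T \<Longrightarrow> inner_product (g t)"
  using flow unfolding ricci_flow_on_def by blast

lemma flow_deriv:
  assumes "t \<in> {0..b}" "ereal b < T"
  shows "((\<lambda>s. g s x y) has_real_derivative - 2 * ricci br (g t) x y) (at t within {0..b})"
proof -
  have sub: "{0..b} \<subseteq> {s. 0 \<le> s \<and> ereal s < T}"
    using assms(2) by (auto intro: le_less_trans[of _ "ereal b"])
  then have "0 \<le> t \<and> ereal t < T"
    using assms(1) by blast
  then show ?thesis
    using flow sub DERIV_subset unfolding ricci_flow_on_def by blast
qed

text \<open>The quotient rule, grouped so that the bracketed term is the Ricci tensor at
  \<open>y\<close> and the part of \<open>x\<close> that is \<open>g t\<close>-orthogonal to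
  \<open>y\<close>.\<close>

lemma ratio_deriv:
  assumes t: "t \<in> {0..b}" "ereal b < T" and "g t y y \<noteq> 0"
  shows "((\<lambda>s. g s x y / g s y y) has_real_derivative
     - 2 * (ricci br (g t) x y - g t x y / g t y y * ricci br (g t) y y) / g t y y)
     (at t within {0..b})"
  using assms(3) by (auto intro!: derivative_eq_intros flow_deriv[OF t] simp: field_simps)

text \<open>The hypothesis \<open>ric\<close> makes the derivative in \<open>ratio_deriv\<close>
  vanish, so the ratio keeps its initial value 0; this is the decay equation with
  \<open>k = 0\<close>.\<close>

lemma component_zero:
  assumes "0 \<le> b" "ereal b < T" "g 0 x y = 0" "y \<noteq> 0"
    and ric: "\<And>t. 0 \<le> t \<Longrightarrow> ereal t < T \<Longrightarrow>
      ricci br (g t) x y = g t x y / g t y y * ricci br (g t) y y"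
  shows "g b x y = 0"
proof -
  have dom: "0 \<le> t" "ereal t < T" if "t \<in> {0..b}" for t
    using that assms(2) by (auto intro: le_less_trans[of _ "ereal b"])
  then have pos: "0 < g t y y" if "t \<in> {0..b}" for t
    using that inner_product_pos[OF inner_product_flow] \<open>y \<noteq> 0\<close> by blast
  have "g b x y / g b y y = 0"
  proof (rule decay_ode_zero[of b "\<lambda>s. g s x y / g s y y"])
    fix t assume t: "t \<in> {0..b}"
    have "((\<lambda>s. g s x y / g s y y) has_real_derivative - 0 * (g t x y / g t y y)) (at t within {0..b})"
      using ratio_deriv[OF t assms(2), of y x] pos[OF t] ric[OF dom[OF t]] by simp
    then show "\<exists>k\<ge>0. ((\<lambda>s. g s x y / g s y y) has_real_derivative - k * (g t x y / g t y y)) (at t within {0..b})"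
      by blast
  qed (use assms in auto)
  then show ?thesis
    using pos[of b] assms(1) by simp
qed

text \<open>The coefficients of \<open>gram_schmidt\<close> for \<open>g t\<close>, written as
  explicit quotients so that they can be differentiated along the flow.\<close>

definition "u t = g t Y2 Y3 / g t Y3 Y3"
definition "v t = (g t Y1 Y2 * g t Y3 Y3 - g t Y1 Y3 * g t Y3 Y2) /
  (g t Y2 Y2 * g t Y3 Y3 - g t Y2 Y3 * g t Y3 Y2)"
definition "w t = (g t Y1 Y3 - v t * g t Y2 Y3) / g t Y3 Y3"

lemma nonzero: "Y1 \<noteq> 0" "Y2 \<noteq> 0" "Y3 \<noteq> 0"
  using spanning_four_basis(2)[OF dim span] by auto

lemma flow_frame:
  assumes "0 \<le> t" "ereal t < T"
  obtains q1 q2 q3 where "orthogonal_engel_frame br (g t) (Y1 - v t *\<^sub>R Y2 - w t *\<^sub>R Y3)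
    (Y2 - u t *\<^sub>R Y3) Y3
    (Y4 - q1 *\<^sub>R (Y1 - v t *\<^sub>R Y2 - w t *\<^sub>R Y3) - q2 *\<^sub>R (Y2 - u t *\<^sub>R Y3) - q3 *\<^sub>R Y3) (u t - v t)"
  using gram_schmidt(2)[OF inner_product_flow[OF assms] u_def v_def w_def] by blast

text \<open>With \<open>c = u - v\<close> the structure constant of the orthogonal frame and \<open>m\<^sub>i\<close> the squared
  norms of its members, the flow gives
  \<open>c' = - (m\<^sub>2 / (m\<^sub>1 m\<^sub>4) + m\<^sub>3 / (m\<^sub>2 m\<^sub>4)) c\<close>.\<close>

lemma u_eq_v:
  assumes b: "0 \<le> b" "ereal b < T"
  shows "u b = v b"
proof -
  have "u b - v b = 0"
  proof (rule decay_ode_zero[of b "\<lambda>t. u t - v t"])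
    show "u 0 - v 0 = 0"
      by (simp add: u_def v_def initial)
    fix t assume t: "t \<in> {0..b}"
    then have dom: "0 \<le> t" "ereal t < T"
      using b by (auto intro: le_less_trans[of _ "ereal b"])
    note gt = inner_product_flow[OF dom]
    let ?Z1 = "Y1 - v t *\<^sub>R Y2 - w t *\<^sub>R Y3" and ?Z2 = "Y2 - u t *\<^sub>R Y3"
    let ?R = "ricci br (g t)" and ?c = "u t - v t"
    obtain Z4 where "orthogonal_engel_frame br (g t) ?Z1 ?Z2 Y3 Z4 ?c"
      using flow_frame[OF dom] by blast
    then interpret Z: orthogonal_engel_frame br "g t" ?Z1 ?Z2 Y3 Z4 ?c .
    note Rl = linear_ricci[OF gt L] and gl = inner_product_linear[OF gt]
    define den where "den s = g s Y2 Y2 * g s Y3 Y3 - g s Y2 Y3 * g s Y3 Y2" for s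
    define num where "num s = g s Y1 Y2 * g s Y3 Y3 - g s Y1 Y3 * g s Y3 Y2" for s
    have den_eq: "den t = Z.m3 * Z.m2"
      unfolding den_def by (rule gram_schmidt(1)[OF gt u_def v_def w_def])
    have pos: "0 < Z.m1" "0 < Z.m2" "0 < Z.m3" "0 < Z.m4"
      by (fact Z.norms_pos)+
    have u': "(u has_real_derivative - 2 * ?R ?Z2 Y3 / Z.m3) (at t within {0..b})"
      using ratio_deriv[OF t b(2), of Y3 Y2] pos(3)
      by (simp add: u_def[abs_def] Rl)
    define dnum where "dnum = ?R Y1 Y2 * g t Y3 Y3 + g t Y1 Y2 * ?R Y3 Y3
      - ?R Y1 Y3 * g t Y3 Y2 - g t Y1 Y3 * ?R Y3 Y2"
    define dden where "dden = ?R Y2 Y2 * g t Y3 Y3 + g t Y2 Y2 * ?R Y3 Y3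
      - ?R Y2 Y3 * g t Y3 Y2 - g t Y2 Y3 * ?R Y3 Y2"
    have num': "(num has_real_derivative - 2 * dnum) (at t within {0..b})"
      and den': "(den has_real_derivative - 2 * dden) (at t within {0..b})"
      unfolding num_def[abs_def] den_def[abs_def] dnum_def dden_def
      by (auto intro!: derivative_eq_intros flow_deriv[OF t b(2)] simp: algebra_simps)
    have v_eq: "v = (\<lambda>s. num s / den s)"
      by (simp add: v_def num_def den_def fun_eq_iff)
    \<comment> \<open>The quotient rule for \<open>v\<close> produces this left side; the
      orthogonality relations of the frame collapse it to a single Ricci component.\<close>
    have "dnum - v t * dden = ?R ?Z1 ?Z2 * Z.m3"
    proof -
      have g23: "g t Y2 Y3 = u t * g t Y3 Y3" "g t Y3 Y2 = u t * g t Y3 Y3"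
        using pos(3) by (simp_all add: u_def inner_product_commute[OF gt, of Y3 Y2])
      have g13: "g t Y1 Y3 = w t * g t Y3 Y3 + v t * g t Y2 Y3"
        using pos(3) by (simp add: w_def)
      have g12: "g t Y1 Y2 = v t * g t Y2 Y2 + w t * g t Y3 Y2"
        using Z.ortho(1,2) by (simp add: gl)
      have R12: "?R ?Z1 ?Z2 = ?R Y1 Y2 - u t * ?R Y1 Y3 - v t * ?R Y2 Y2
          + v t * u t * ?R Y2 Y3 - w t * ?R Y3 Y2 + w t * u t * ?R Y3 Y3"
        by (simp add: Rl right_diff_distrib)
      show ?thesis
        unfolding dnum_def dden_def g12 g13 g23 R12 by (simp add: algebra_simps)
    qed
    moreover have "(v has_real_derivative - 2 * (dnum - v t * dden) / den t) (at t within {0..b})"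
      unfolding v_eq using pos den_eq
      by (auto intro!: derivative_eq_intros num' den' simp: field_simps)
    ultimately have v': "(v has_real_derivative - 2 * ?R ?Z1 ?Z2 / Z.m2) (at t within {0..b})"
      using pos den_eq by (simp add: field_simps)
    \<comment> \<open>By \<open>ricci_frame\<close> both Ricci terms are negative multiples of
      \<open>?c\<close>, so they reinforce each other.\<close>
    have "((\<lambda>t. u t - v t) has_real_derivative
        - (Z.m2 / (Z.m1 * Z.m4) + Z.m3 / (Z.m2 * Z.m4)) * ?c) (at t within {0..b})"
      by (rule DERIV_cong[OF DERIV_diff[OF u' v']])
        (unfold Z.ricci_frame, insert pos, simp add: field_simps)
    then show "\<exists>k\<ge>0. ((\<lambda>t. u t - v t) has_real_derivative - k * (u t - v t)) (at t within {0..b})"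
      using pos by (intro exI[of _ "Z.m2 / (Z.m1 * Z.m4) + Z.m3 / (Z.m2 * Z.m4)"]) simp
  qed (use b in simp)
  then show ?thesis by simp
qed

text \<open>By \<open>u_eq_v\<close> the structure constant is 0, so Ricci vanishes on
  \<open>Y2 - u t *\<^sub>R Y3\<close> and \<open>Y3\<close>, which is the condition of
  \<open>component_zero\<close>.\<close>

lemma ortho23:
  assumes "0 \<le> t" "ereal t < T"
  shows "g t Y2 Y3 = 0"
proof (rule component_zero[OF assms initial(3) nonzero(3)])
  fix t assume t: "0 \<le> t" "ereal t < T"
  obtain Z4 where "orthogonal_engel_frame br (g t) (Y1 - v t *\<^sub>R Y2 - w t *\<^sub>R Y3)
      (Y2 - u t *\<^sub>R Y3) Y3 Z4 (u t - v t)"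
    using flow_frame[OF t] by blast
  from orthogonal_engel_frame.ricci_frame(2)[OF this]
  show "ricci br (g t) Y2 Y3 = g t Y2 Y3 / g t Y3 Y3 * ricci br (g t) Y3 Y3"
    by (simp add: u_eq_v[OF t] linear_ricci[OF inner_product_flow[OF t] L])
      (simp add: u_eq_v[OF t, symmetric] u_def)
qed

lemma u_v_zero:
  assumes "0 \<le> t" "ereal t < T"
  shows "u t = 0" "v t = 0"
  using u_eq_v[OF assms] by (simp_all add: u_def ortho23[OF assms])

text \<open>Now \<open>u\<close> and \<open>v\<close> vanish, so the first frame vector is
  \<open>Y1 - w t *\<^sub>R Y3\<close>, and its Ricci component with \<open>Y3\<close> is 0.\<close>

lemma ortho13:
  assumes "0 \<le> t" "ereal t < T"
  shows "g t Y1 Y3 = 0"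
proof (rule component_zero[OF assms initial(2) nonzero(3)])
  fix t assume t: "0 \<le> t" "ereal t < T"
  obtain Z4 where "orthogonal_engel_frame br (g t) (Y1 - v t *\<^sub>R Y2 - w t *\<^sub>R Y3)
      (Y2 - u t *\<^sub>R Y3) Y3 Z4 (u t - v t)"
    using flow_frame[OF t] by blast
  from orthogonal_engel_frame.ricci_frame(3)[OF this]
  show "ricci br (g t) Y1 Y3 = g t Y1 Y3 / g t Y3 Y3 * ricci br (g t) Y3 Y3"
    by (simp add: u_v_zero[OF t] linear_ricci[OF inner_product_flow[OF t] L] w_def)
qed

text \<open>All three coefficients vanish by now, so only \<open>Y4\<close> still has to be
  corrected.\<close>

lemma flow_frame_Y:
  assumes "0 \<le> t" "ereal t < T"
  obtains q1 q2 q3 where "orthogonal_engel_frame br (g t) Y1 Y2 Y3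
    (Y4 - q1 *\<^sub>R Y1 - q2 *\<^sub>R Y2 - q3 *\<^sub>R Y3) 0"
  using flow_frame[OF assms] by (simp add: u_v_zero[OF assms] w_def ortho13[OF assms]) blast

text \<open>Each \<open>q\<close> coefficient is the ratio \<open>g t Y4 y / g t y y\<close> for its
  \<open>y\<close>. Ricci vanishes on the corrected \<open>Y4\<close> and \<open>y\<close>, and with
  \<open>c = 0\<close> also between distinct \<open>Y1\<close>, \<open>Y2\<close>,
  \<open>Y3\<close>.\<close>

lemma ortho4:
  assumes "0 \<le> t" "ereal t < T"
  shows "g t Y4 Y1 = 0" "g t Y4 Y2 = 0" "g t Y4 Y3 = 0"
proof -
  have "ricci br (g t) Y4 Y1 = g t Y4 Y1 / g t Y1 Y1 * ricci br (g t) Y1 Y1 \<and>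
    ricci br (g t) Y4 Y2 = g t Y4 Y2 / g t Y2 Y2 * ricci br (g t) Y2 Y2 \<and>
    ricci br (g t) Y4 Y3 = g t Y4 Y3 / g t Y3 Y3 * ricci br (g t) Y3 Y3"
    if t: "0 \<le> t" "ereal t < T" for t
  proof -
    note gt = inner_product_flow[OF t]
    obtain q1 q2 q3 where "orthogonal_engel_frame br (g t) Y1 Y2 Y3
        (Y4 - q1 *\<^sub>R Y1 - q2 *\<^sub>R Y2 - q3 *\<^sub>R Y3) 0"
      using flow_frame_Y[OF t] .
    then interpret Z: orthogonal_engel_frame br "g t" Y1 Y2 Y3
      "Y4 - q1 *\<^sub>R Y1 - q2 *\<^sub>R Y2 - q3 *\<^sub>R Y3" 0 .
    have "g t Y4 Y1 = q1 * Z.m1" "g t Y4 Y2 = q2 * Z.m2" "g t Y4 Y3 = q3 * Z.m3"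
      using Z.ortho Z.ortho' by (simp_all add: inner_product_linear[OF gt])
    then show ?thesis
      using Z.ricci_frame Z.ricci_frame' Z.norms_pos(1-3) by (simp add: linear_ricci[OF gt L])
  qed
  then show "g t Y4 Y1 = 0" "g t Y4 Y2 = 0" "g t Y4 Y3 = 0"
    using component_zero[OF assms initial(4) nonzero(1)]
      component_zero[OF assms initial(5) nonzero(2)]
      component_zero[OF assms initial(6) nonzero(3)] by blast+
qed

lemma flow_diagonal:
  assumes "0 \<le> t" "ereal t < T"
  shows "g t Y1 Y2 = 0" "g t Y1 Y3 = 0" "g t Y2 Y3 = 0"
    "g t Y4 Y1 = 0" "g t Y4 Y2 = 0" "g t Y4 Y3 = 0"
proof -
  obtain Z4 where "orthogonal_engel_frame br (g t) Y1 Y2 Y3 Z4 0"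
    using flow_frame_Y[OF assms] by blast
  from orthogonal_engel_frame.ortho(1)[OF this] show "g t Y1 Y2 = 0" .
qed (use ortho13 ortho23 ortho4 assms in auto)

end

section \<open>Diagonality of the flow in the basis \<open>Y\<close> and the condition
  \<open>a1 = a2\<close>\<close>

theorem proposition5:
  fixes br :: "'a::euclidean_space \<Rightarrow> 'a \<Rightarrow> 'a"
    and X1 X2 X3 X4 :: 'a
    and a1 a2 a3 a4 a5 a6 :: real
    and Y :: "nat \<Rightarrow> 'a"
    and lam :: "nat \<Rightarrow> real"
    and g0 :: "'a \<Rightarrow> 'a \<Rightarrow> real"
    and T :: ereal
    and g :: "real \<Rightarrow> 'a \<Rightarrow> 'a \<Rightarrow> real"
  assumes "lie_bracket br"
    and "distinct [X1, X2, X3, X4]"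
    and "independent {X1, X2, X3, X4}"
    and "span {X1, X2, X3, X4} = UNIV"
    and "br X2 X3 = 0" and "br X3 X1 = 0" and "br X1 X2 = 0"
    and "br X1 X4 = X2" and "br X2 X4 = X3" and "br X3 X4 = 0"
    and "Y 1 = X1 + a2 *\<^sub>R X2 + a3 *\<^sub>R X3"
    and "Y 2 = X2 + a1 *\<^sub>R X3"
    and "Y 3 = X3"
    and "Y 4 = a4 *\<^sub>R X1 + a5 *\<^sub>R X2 + a6 *\<^sub>R X3 + X4"
    and "inner_product g0"
    and "\<And>i. i \<in> {1..4} \<Longrightarrow> lam i > 0"
    and "\<And>i j. i \<in> {1..4} \<Longrightarrow> j \<in> {1..4} \<Longrightarrow> g0 (Y i) (Y j) = (if i = j then lam i else 0)"
    and "maximal_ricci_flow br g0 T g"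
  shows "(\<forall>t. 0 \<le> t \<and> ereal t < T \<longrightarrow>
            (\<forall>i\<in>{1..4}. \<forall>j\<in>{1..4}. i \<noteq> j \<longrightarrow> g t (Y i) (Y j) = 0))
         \<longleftrightarrow> a1 = a2"
proof -
  note L = assms(1) and X = assms(2-4) and brX = assms(5-10) and Y = assms(11-14)
    and g0 = assms(15) and diag = assms(17)
  have T: "0 < T" and flow: "ricci_flow_on br T g" and g_0: "g 0 = g0"
    using assms(18) unfolding maximal_ricci_flow_def by auto
  have dim: "DIM('a) = 4"
    using dim_span_eq_card_independent[OF X(2)] X by simp
  have span: "span {Y 1, Y 2, Y 3, Y 4} = UNIV"
  proof (rule span_UNIV_mono[OF assms(4)])
    let ?S = "span {Y 1, Y 2, Y 3, Y 4}"
    have mem: "Y 1 \<in> ?S" "Y 2 \<in> ?S" "Y 3 \<in> ?S" "Y 4 \<in> ?S"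
      by (auto intro: span_base)
    have X3: "X3 \<in> ?S"
      using mem(3) Y(3) by simp
    have "Y 2 - a1 *\<^sub>R X3 \<in> ?S"
      by (intro span_diff span_scale mem X3)
    then have X2: "X2 \<in> ?S"
      by (simp add: Y del: One_nat_def)
    have "Y 1 - a2 *\<^sub>R X2 - a3 *\<^sub>R X3 \<in> ?S"
      by (intro span_diff span_scale mem X2 X3)
    then have X1: "X1 \<in> ?S"
      by (simp add: Y del: One_nat_def)
    have "Y 4 - a4 *\<^sub>R X1 - a5 *\<^sub>R X2 - a6 *\<^sub>R X3 \<in> ?S"
      by (intro span_diff span_scale mem X1 X2 X3)
    then have "X4 \<in> ?S"
      by (simp add: Y del: One_nat_def)
    with X1 X2 X3 show "{X1, X2, X3, X4} \<subseteq> ?S"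
      by simp
  qed
  have brX': "br X3 X2 = 0" "br X1 X3 = 0" "br X2 X1 = 0"
    by (subst lie_bracket_anti[OF L], simp add: brX)+
  \<comment> \<open>The parameters enter the brackets only through \<open>a2 - a1\<close>, since
    \<open>br (Y 1) (Y 4) = X2 + a2 *\<^sub>R X3\<close>.\<close>
  have brY: "br (Y 1) (Y 2) = 0" "br (Y 1) (Y 3) = 0" "br (Y 2) (Y 3) = 0"
    "br (Y 1) (Y 4) = Y 2 + (a2 - a1) *\<^sub>R Y 3" "br (Y 2) (Y 4) = Y 3" "br (Y 3) (Y 4) = 0"
    by (simp_all add: Y lie_bracket_linear[OF L] brX brX' algebra_simps del: One_nat_def)
  have diag0: "g0 (Y 1) (Y 2) = 0" "g0 (Y 1) (Y 3) = 0" "g0 (Y 1) (Y 4) = 0"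
    "g0 (Y 2) (Y 3) = 0" "g0 (Y 2) (Y 4) = 0" "g0 (Y 3) (Y 4) = 0"
    "g0 (Y 4) (Y 1) = 0" "g0 (Y 4) (Y 2) = 0" "g0 (Y 4) (Y 3) = 0"
    by (simp_all add: diag del: One_nat_def)
  show ?thesis
  proof
    assume stays: "\<forall>t. 0 \<le> t \<and> ereal t < T \<longrightarrow>
      (\<forall>i\<in>{1..4}. \<forall>j\<in>{1..4}. i \<noteq> j \<longrightarrow> g t (Y i) (Y j) = 0)"
    interpret Z: orthogonal_engel_frame br g0 "Y 1" "Y 2" "Y 3" "Y 4" "a2 - a1"
      by unfold_locales (use L g0 dim span brY diag0 in \<open>auto simp del: One_nat_def\<close>)
    \<comment> \<open>A nondegenerate closed interval inside the domain makes the one-sided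
      derivative at 0 unique, also when \<open>T\<close> is infinite.\<close>
    obtain b where b: "0 < b" "ereal b < T"
      using ereal_dense2[OF T] by auto
    have dom: "0 \<le> t \<and> ereal t < T" if "t \<in> {0..b}" for t
      using that b by (auto intro: le_less_trans[of _ "ereal b"])
    have "((\<lambda>s. g s (Y 2) (Y 3)) has_real_derivative - 2 * ricci br g0 (Y 2) (Y 3))
        (at 0 within {s. 0 \<le> s \<and> ereal s < T})"
      using flow dom[of 0] b(1) g_0 unfolding ricci_flow_on_def by fastforce
    moreover have "{0..b} \<subseteq> {s. 0 \<le> s \<and> ereal s < T}"
      using dom by blast
    ultimately have "((\<lambda>s. g s (Y 2) (Y 3)) has_vector_derivative - 2 * ricci br g0 (Y 2) (Y 3))
        (at 0 within cbox 0 b)"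
      unfolding has_real_derivative_iff_has_vector_derivative[symmetric] cbox_interval
      by (rule DERIV_subset)
    moreover have "((\<lambda>s. g s (Y 2) (Y 3)) has_vector_derivative 0) (at 0 within cbox 0 b)"
    proof (rule has_vector_derivative_transform[of 0 _ _ "\<lambda>_. 0"])
      show "g s (Y 2) (Y 3) = 0" if "s \<in> cbox 0 b" for s
        using stays dom[of s] that by simp
    qed (use b(1) in auto)
    \<comment> \<open>The flow equation and the vanishing of the component give two values for the
      same derivative at 0; the Ricci entry is a nonzero multiple of \<open>a2 - a1\<close>.\<close>
    ultimately have "- 2 * ricci br g0 (Y 2) (Y 3) = 0"
      by (rule vector_derivative_unique_within_closed_interval[rotated 2]) (use b(1) in auto)
    then show "a1 = a2"
      using Z.norms_pos by (simp add: Z.ricci_frame)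
  next
    assume "a1 = a2"
    then interpret F: engel_flow br "Y 1" "Y 2" "Y 3" "Y 4" T g
      by unfold_locales (use L dim span brY diag0 flow g_0 in \<open>auto simp del: One_nat_def\<close>)
    have idx: "{1..4} = {1, 2, 3, 4 :: nat}"
      by auto
    have "g t (Y i) (Y j) = 0" if t: "0 \<le> t" "ereal t < T" and ij: "i \<in> {1..4}" "j \<in> {1..4}" "i \<noteq> j"
      for t i j
      using ij F.flow_diagonal[OF t] inner_product_commute[OF F.inner_product_flow[OF t]]
      unfolding idx by auto
    then show "\<forall>t. 0 \<le> t \<and> ereal t < T \<longrightarrow>
      (\<forall>i\<in>{1..4}. \<forall>j\<in>{1..4}. i \<noteq> j \<longrightarrow> g t (Y i) (Y j) = 0)"
      by blast
  qed
qed

end
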